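(* For every $n\ge2$, $|K_{U_n}|=2^{n-1}+1$.
   Context: For a finite integer sequence $S=(s_1,\ldots,s_n)$, its difference triangle is defined by $s_a^0:=s_a$ and $s_a^b:=|s_{a+1}^{b-1}-s_a^{b-1}|$ for $b\ge 1$, $1\le a\le n-b$ (superscripts of $s$ are row indices, not powers). $S$ is Gilbreath if $s_1^b=1$ for every $1\le b\le n-1$. The valid-extension set of a Gilbreath sequence $S$ is $K_S:=\{k\in\mathbb{Z}:(s_1,\ldots,s_n,k)\text{ is Gilbreath}\}$. $U_n=(2,3,5,9,17,\ldots,2^{n-1}+1)$ is the doubling sequence of length $n$: its first term is $2$ and its $i$-th term is $2^{i-1}+1$ for $2\le i\le n$. *)

theory Defs
  imports Main
begin

text \<open>Positions are counted from 0: \<open>diff_tri S b a\<close> is the entry in row \<open>b\<close> and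
  (1-based) position \<open>a + 1\<close>. It is meaningful only for \<open>a + b < length S\<close>; otherwise
  it refers to list elements out of range.\<close>

primrec diff_tri :: "int list \<Rightarrow> nat \<Rightarrow> nat \<Rightarrow> int" where
  "diff_tri S 0 a = S ! a"
| "diff_tri S (Suc b) a = \<bar>diff_tri S b (a + 1) - diff_tri S b a\<bar>"

definition gilbreath :: "int list \<Rightarrow> bool" where
  "gilbreath S \<longleftrightarrow> (\<forall>b. 1 \<le> b \<and> b \<le> length S - 1 \<longrightarrow> diff_tri S b 0 = 1)"

definition valid_extensions :: "int list \<Rightarrow> int set" where
  "valid_extensions S = {k. gilbreath (S @ [k])}"

text \<open>The first term needs no separate case, since \<open>2 ^ 0 + 1 = 2\<close>.\<close>

definition doubling_seq :: "nat \<Rightarrow> int list" where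
  "doubling_seq n = map (\<lambda>i. 2 ^ i + 1) [0..<n]"

end

(* Every row of the triangle of U_n below the top one is 1, 2, 4, 8, ..., so when k is appended
   the new entry x of row b \<ge> 1 yields the new entry |x - 2^j| of row b + 1, where j = n - b - 1.
   Going up from the required entry 1 in row n, x has to be an even number in [0, 2^(j+1)]: for
   j = 0 these are the solutions 0, 2 of |x - 1| = 1, and for j > 0 they are the x \<ge> 0 such that
   |x - 2^j| is even and at most 2^j. In the top row this says that k is odd and
   1 \<le> k \<le> 2^n + 1. *)

theory Submission
  imports Defs
begin

lemma diff_tri_nonneg: "1 \<le> b \<Longrightarrow> 0 \<le> diff_tri S b a"
  by (cases b) auto

lemma doubling_seq_append_nth:
  "a < n \<Longrightarrow> (doubling_seq n @ [k]) ! a = 2 ^ a + 1"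
  "(doubling_seq n @ [k]) ! n = k"
  by (simp_all add: doubling_seq_def nth_append)

text \<open>The bound \<open>a + b < n\<close> keeps the entry clear of \<open>k\<close>, and
  adjacent powers of two differ by the smaller one.\<close>

lemma diff_tri_doubling_seq_append:
  assumes "1 \<le> b" "a + b < n"
  shows "diff_tri (doubling_seq n @ [k]) b a = 2 ^ a"
  using assms
proof (induction b arbitrary: a rule: nat_induct_at_least)
  case base
  then show ?case
    by (simp add: doubling_seq_append_nth)
next
  case (Suc b)
  then show ?case
    by simp
qed

text \<open>Subtracting an even \<open>c\<close> keeps parity; of the two bounds,
  \<open>c - x \<le> c\<close> is just \<open>0 \<le> x\<close>.\<close>

lemma even_abs_diff_le_iff:
  fixes x c :: int
  assumes "0 \<le> x" "even c"
  shows "even \<bar>x - c\<bar> \<and> \<bar>x - c\<bar> \<le> c \<longleftrightarrow> even x \<and> x \<le> 2 * c"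
  using assms by auto

text \<open>Position \<open>j\<close> ends row \<open>n - j\<close>, so its entry depends on
  \<open>k\<close>. Induction on \<open>j\<close> climbs from row \<open>n - 1\<close>;
  \<open>j < n\<close> stops it at row 1, since \<open>k\<close> itself may be negative.\<close>

lemma apex_eq_1_iff:
  assumes "1 \<le> j" "j < n"
  shows "diff_tri (doubling_seq n @ [k]) n 0 = 1 \<longleftrightarrow>
    even (diff_tri (doubling_seq n @ [k]) (n - j) j) \<and>
    diff_tri (doubling_seq n @ [k]) (n - j) j \<le> 2 ^ j"
  using assms
proof (induction j rule: nat_induct_at_least)
  case base
  let ?x = "diff_tri (doubling_seq n @ [k]) (n - 1) 1"
  have "diff_tri (doubling_seq n @ [k]) (Suc (n - 1)) 0 = \<bar>?x - 1\<bar>"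
    using base by (simp add: diff_tri_doubling_seq_append del: Suc_pred Suc_diff_1)
  moreover have "0 \<le> ?x"
    using base by (intro diff_tri_nonneg) simp
  moreover have "Suc (n - 1) = n"
    using base by simp
  ultimately show ?case
    by (simp, presburger)
next
  case (Suc j)
  let ?b = "n - Suc j"
  let ?x = "diff_tri (doubling_seq n @ [k]) ?b (Suc j)"
  have "n - j = Suc ?b"
    using Suc.prems by simp
  then have "diff_tri (doubling_seq n @ [k]) (n - j) j = \<bar>?x - 2 ^ j\<bar>"
    using Suc.prems by (simp add: diff_tri_doubling_seq_append)
  moreover have "0 \<le> ?x"
    using Suc.prems by (intro diff_tri_nonneg) simp
  \<comment> \<open>The induction starts at 1 because \<open>2 ^ 0\<close> is odd.\<close>
  moreover have "even (2 ^ j :: int)"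
    using Suc.hyps by simp
  ultimately show ?case
    using Suc even_abs_diff_le_iff[of ?x "2 ^ j"] by simp
qed

text \<open>Rows 1 to \<open>n - 1\<close> begin with \<open>2 ^ 0\<close> whatever \<open>k\<close>
  is.\<close>

lemma gilbreath_doubling_seq_append_iff:
  assumes "1 \<le> n"
  shows "gilbreath (doubling_seq n @ [k]) \<longleftrightarrow> diff_tri (doubling_seq n @ [k]) n 0 = 1"
proof -
  have "length (doubling_seq n @ [k]) - 1 = n"
    by (simp add: doubling_seq_def)
  moreover have "diff_tri (doubling_seq n @ [k]) b 0 = 1" if "1 \<le> b" "b < n" for b
    using that diff_tri_doubling_seq_append[of b 0 n k] by simp
  ultimately show ?thesis
    using assms unfolding gilbreath_def by (metis le_neq_implies_less order_refl)
qed

lemma valid_extensions_doubling_seq: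
  assumes "2 \<le> n"
  shows "valid_extensions (doubling_seq n) = (\<lambda>m. 2 * m + 1) ` {0..2 ^ (n - 1)}"
proof -
  define c :: int where "c = 2 ^ (n - 1)"
  have "even c"
    using assms by (simp add: c_def)
  have "gilbreath (doubling_seq n @ [k]) \<longleftrightarrow> (\<exists>m. 0 \<le> m \<and> m \<le> c \<and> k = 2 * m + 1)" for k
  proof -
    \<comment> \<open>This is the end of row 1; \<open>c + 1\<close> is the last term before
      \<open>k\<close>.\<close>
    have "diff_tri (doubling_seq n @ [k]) (n - (n - 1)) (n - 1) = \<bar>k - (c + 1)\<bar>"
      using assms doubling_seq_append_nth(1)[of "n - 1" n k] doubling_seq_append_nth(2)[of n k]
      by (simp add: c_def)
    then have "gilbreath (doubling_seq n @ [k]) \<longleftrightarrow>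
        even \<bar>k - (c + 1)\<bar> \<and> \<bar>k - (c + 1)\<bar> \<le> c"
      using assms apex_eq_1_iff[of "n - 1" n k]
      by (simp add: gilbreath_doubling_seq_append_iff c_def)
    then show ?thesis
      \<comment> \<open>Since \<open>c + 1\<close> is odd, \<open>k\<close> is odd with 1 \<le>
        \<open>k\<close> \<le> \<open>2 * c + 1\<close>, so \<open>m\<close> is
        \<open>(k - 1) div 2\<close>.\<close>
      using \<open>even c\<close> by presburger
  qed
  then show ?thesis
    unfolding valid_extensions_def c_def by auto
qed

theorem theorem29:
  fixes n :: nat
  assumes "n \<ge> 2"
  shows "card (valid_extensions (doubling_seq n)) = 2 ^ (n - 1) + 1"
proof -
  have "card ((\<lambda>m. 2 * m + 1) ` {0..2 ^ (n - 1) :: int}) = card {0..2 ^ (n - 1) :: int}"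
    by (intro card_image inj_onI) simp
  also have "\<dots> = 2 ^ (n - 1) + 1"
    by (simp add: nat_add_distrib nat_power_eq)
  finally show ?thesis
    by (simp add: valid_extensions_doubling_seq[OF assms])
qed

end
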